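(* Let $G$ be a finite cyclic group of order $n$, and let $\kappa(P^\ast(G))$ denote the vertex connectivity of the proper power graph of $G$. Then: (i) $\kappa(P^\ast(G)) = n-2$ when $G$ is a $p$-group for some prime $p$; (ii) $\kappa(P^\ast(G)) = \phi(n)$ when the order of $G$ is $pq$, where $p$ and $q$ are distinct primes; (iii) $\kappa(P^\ast(G)) > \phi(n)$ when $G$ is neither a $p$-group (for any prime $p$) nor a cyclic group of order $pq$ (with $p,q$ distinct primes).
   Context: The power graph $P(G)$ of a group $G$ is the simple undirected graph with vertex set $G$ in which two distinct vertices $a,b$ are adjacent if and only if $a\in\langle b\rangle$ or $b\in\langle a\rangle$. The proper power graph $P^\ast(G)$ is the graph obtained from $P(G)$ by deleting the vertex corresponding to the identity element. The vertex connectivity $\kappa(\Gamma)$ of a graph $\Gamma$ is the minimum size of a vertex set $S$ such that $\Gamma - S$ is disconnected or has only one vertex. $\phi$ is Euler's totient function. *)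

theory Defs
  imports
    "HOL-Algebra.Elementary_Groups"
    "HOL-Algebra.Multiplicative_Group"
    "HOL-Number_Theory.Totient"
    "Graph_Theory.Digraph_Component"
begin

(* Following the Graph_Theory library, simple undirected graphs are loop-free symmetric
   digraphs without parallel arcs. *)

definition power_graph :: "('a, 'm) monoid_scheme \<Rightarrow> 'a pair_pre_digraph" where
  "power_graph G =
     \<lparr> pverts = carrier G,
       parcs = {(a, b). a \<in> carrier G \<and> b \<in> carrier G \<and> a \<noteq> b \<and>
                  (a \<in> generate G {b} \<or> b \<in> generate G {a})} \<rparr>"

definition proper_power_graph ::
    "('a, 'm) monoid_scheme \<Rightarrow> ('a, 'a \<times> 'a) pre_digraph" where
  "proper_power_graph G = pre_digraph.del_vert (with_proj (power_graph G)) \<one>\<^bsub>G\<^esub>"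

(* The library's connected is false on the graph without vertices, so S = verts \<Gamma> is
   admissible. This never affects the minimum if \<Gamma> has a vertex, since deleting all
   vertices but one is admissible too; the graph without vertices gets connectivity 0.
   The condition finite S is there because card is 0 on infinite sets. *)
definition vertex_connectivity :: "('v, 'e) pre_digraph \<Rightarrow> nat" where
  "vertex_connectivity \<Gamma> =
     (LEAST k. \<exists>S. S \<subseteq> verts \<Gamma> \<and> finite S \<and> card S = k \<and>
        (\<not> Digraph_Component.connected (\<Gamma> \<restriction> (verts \<Gamma> - S)) \<or>
         card (verts (\<Gamma> \<restriction> (verts \<Gamma> - S))) = 1))"

(* The trivial group is a p-group for every prime p. *)
definition p_group :: "nat \<Rightarrow> ('a, 'm) monoid_scheme \<Rightarrow> bool" where
  "p_group p G \<longleftrightarrow>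
     group G \<and> prime p \<and> (\<forall>x \<in> carrier G. \<exists>k. group.ord G x = p ^ k)"

end

theory Submission
  imports Defs
begin

text \<open>In a cyclic group of order \<open>n\<close>, \<open>x \<in> \<langle>y\<rangle>\<close> holds iff the order of \<open>x\<close> divides the order of \<open>y\<close>,
  so the generators are adjacent to all vertices and every disconnecting set contains all
  \<open>\<phi>(n)\<close> of them. For \<open>n = p ^ k\<close> the graph is complete. For \<open>n = p * q\<close> the remaining vertices have
  order \<open>p\<close> or \<open>q\<close>, and the two kinds are not joined. If \<open>n\<close> is neither a prime power nor a product
  of two distinct primes, two nongenerators \<open>u\<close> and \<open>v\<close> with primes \<open>p\<close>, \<open>q\<close> dividing their orders are
  joined through elements of orders \<open>p\<close>, \<open>lcm p q\<close> and \<open>q\<close>; as \<open>lcm p q \<noteq> n\<close>, this path avoids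
  the generators, so removing exactly the generators does not separate.\<close>

section \<open>Separating sets and the minimum defining the connectivity\<close>

definition separating_set :: "('v, 'e) pre_digraph \<Rightarrow> 'v set \<Rightarrow> bool" where
  "separating_set \<Gamma> S \<longleftrightarrow> S \<subseteq> verts \<Gamma> \<and> finite S \<and>
     (\<not> Digraph_Component.connected (\<Gamma> \<restriction> (verts \<Gamma> - S)) \<or> card (verts \<Gamma> - S) = 1)"

lemma vertex_connectivity_alt:
  "vertex_connectivity \<Gamma> = (LEAST k. \<exists>S. separating_set \<Gamma> S \<and> card S = k)"
  unfolding vertex_connectivity_def separating_set_def
  by (rule arg_cong[of _ _ Least]) auto

lemma vertex_connectivity_eqI:
  assumes "separating_set \<Gamma> S" "\<And>T. separating_set \<Gamma> T \<Longrightarrow> card S \<le> card T"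
  shows "vertex_connectivity \<Gamma> = card S"
  unfolding vertex_connectivity_alt using assms by (intro Least_equality) auto

text \<open>The graph without vertices is not \<open>connected\<close>, so deleting everything
  separates. Hence the minimum ranges over a nonempty set; the trivial group is also handled this
  way.\<close>

lemma finite_verts_separating_set:
  assumes "finite (verts \<Gamma>)"
  shows "separating_set \<Gamma> (verts \<Gamma>)"
  using assms by (simp add: separating_set_def connected_conv)

lemma vertex_connectivity_attained:
  assumes "finite (verts \<Gamma>)"
  obtains S where "separating_set \<Gamma> S" "card S = vertex_connectivity \<Gamma>"
proof -
  let ?P = "\<lambda>k. \<exists>S. separating_set \<Gamma> S \<and> card S = k"
  have "?P (card (verts \<Gamma>))" using finite_verts_separating_set[OF assms] by blast
  then have "?P (Least ?P)" by (rule LeastI[of ?P])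
  then show thesis using that unfolding vertex_connectivity_alt by blast
qed

lemma verts_proper_power_graph [simp]:
  "verts (proper_power_graph G) = carrier G - {\<one>\<^bsub>G\<^esub>}"
  by (simp add: proper_power_graph_def power_graph_def pre_digraph.del_vert_def)

section \<open>Element orders in a finite cyclic group\<close>

locale finite_cyclic_group = group G for G (structure) +
  fixes g
  assumes finite_carrier: "finite (carrier G)"
    and gen_closed [simp]: "g \<in> carrier G"
    and ord_gen: "ord g = order G"
begin

abbreviation n where "n \<equiv> order G"

abbreviation nonid where "nonid \<equiv> carrier G - {\<one>}"

abbreviation gens where "gens \<equiv> {x \<in> carrier G. ord x = n}"

lemma order_pos: "n > 0"
  using finite_carrier by (simp add: order_gt_0_iff_finite)

lemma generate_gen: "generate G {g} = carrier G"
proof (rule card_subset_eq[OF finite_carrier])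
  show "generate G {g} \<subseteq> carrier G" by (simp add: generate_incl)
  show "card (generate G {g}) = card (carrier G)"
    using generate_pow_card[OF gen_closed] ord_gen by (simp add: order_def)
qed

lemma obtain_exponent:
  assumes "x \<in> carrier G"
  obtains i :: nat where "x = g [^] i"
  using assms generate_pow_on_finite_carrier[OF finite_carrier gen_closed] generate_gen by auto

lemma obtain_element_of_order:
  assumes "d dvd n"
  obtains x where "x \<in> carrier G" "ord x = d"
proof
  show "g [^] (n div d) \<in> carrier G" by simp
  show "ord (g [^] (n div d)) = d"
    using assms order_pos ord_pow[OF gen_closed, of "n div d"]
    by (auto simp: ord_gen dvd_def)
qed

text \<open>Let d be the order of \<open>y\<close> and \<open>h\<close> the power of
  \<open>g\<close> with exponent n/d. Every x with x^d = 1 is a power of \<open>h\<close>, so there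
  are at most d of them. The d elements of \<open>generate G {y}\<close> are such x, and counting
  gives equality.\<close>

lemma roots_of_unity_eq_generate:
  assumes y: "y \<in> carrier G"
  shows "{x \<in> carrier G. x [^] ord y = \<one>} = generate G {y}"
proof -
  define d where "d = ord y"
  have "d dvd n" unfolding d_def using y by (rule ord_dvd_group_order)
  then obtain m where m: "n = d * m" by (rule dvdE)
  have pos: "d > 0" "m > 0" using m order_pos by auto
  define h where "h = g [^] m"
  have h: "h \<in> carrier G" "ord h = d"
    using ord_pow[OF gen_closed, of m] pos by (auto simp: h_def ord_gen m)
  let ?R = "{x \<in> carrier G. x [^] d = \<one>}"
  have R: "?R \<subseteq> generate G {h}"
  proof
    fix x assume x: "x \<in> ?R"
    then obtain i :: nat where i: "x = g [^] i" using obtain_exponent by blast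
    with x have "d * m dvd i * d"
      by (simp add: nat_pow_pow pow_eq_id ord_gen m)
    then have "m dvd i" using pos by (simp add: mult.commute)
    then obtain k where "i = m * k" by (rule dvdE)
    then have "x = h [^] k" by (simp add: i h_def nat_pow_pow)
    then show "x \<in> generate G {h}"
      using generate_pow_on_finite_carrier[OF finite_carrier h(1)] by blast
  qed
  have fin: "finite (generate G {h})"
    using finite_subset[OF generate_incl finite_carrier] h(1) by simp
  have "generate G {y} \<subseteq> ?R"
    using generate_pow_on_finite_carrier[OF finite_carrier y] y
    by (auto simp: d_def pow_eq_id nat_pow_pow)
  moreover have "finite ?R" using finite_carrier by simp
  moreover have "card ?R \<le> card (generate G {y})"
    using card_mono[OF fin R] generate_pow_card[OF y] generate_pow_card[OF h(1)] h(2)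
    by (simp add: d_def)
  ultimately have "generate G {y} = ?R" by (intro card_seteq)
  then show ?thesis by (simp only: d_def)
qed

lemma in_generate_iff_ord_dvd:
  assumes "x \<in> carrier G" "y \<in> carrier G"
  shows "x \<in> generate G {y} \<longleftrightarrow> ord x dvd ord y"
  by (simp add: assms pow_eq_id flip: roots_of_unity_eq_generate)

lemma card_gens: "card gens = totient n"
proof -
  have "bij_betw (\<lambda>i. g [^] i) (totatives n) gens"
  proof (rule bij_betw_imageI)
    show "inj_on (\<lambda>i. g [^] i) (totatives n)"
      by (rule inj_on_subset[OF ord_inj'[OF gen_closed]]) (auto simp: totatives_def ord_gen)
    show "(\<lambda>i. g [^] i) ` totatives n = gens"
    proof (intro equalityI subsetI)
      fix x assume "x \<in> (\<lambda>i. g [^] i) ` totatives n"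
      then show "x \<in> gens"
        using pow_ord_eq_ord_iff[OF finite_carrier gen_closed]
        by (auto simp: totatives_def ord_gen)
    next
      fix x assume x: "x \<in> gens"
      then obtain i :: nat where i: "x = g [^] i" using obtain_exponent by blast
      with x have cop: "coprime i n"
        using pow_ord_eq_ord_iff[OF finite_carrier gen_closed, of i] by (simp add: ord_gen)
      show "x \<in> (\<lambda>i. g [^] i) ` totatives n"
      \<comment> \<open>Totatives are positive, so for n = 1 the residue \<open>i mod n\<close> = 0
        is not one, and the exponent 1 is taken instead.\<close>
      proof (cases "n = 1")
        case True
        then have "x = g" using x ord_gen ord_eq_1[of x] ord_eq_1[of g] by simp
        then show ?thesis using True by (intro image_eqI[of _ _ 1]) (simp_all add: totatives_def)
      next
        case False
        let ?j = "i mod n"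
        have "coprime ?j n" using cop order_pos by simp
        moreover from this have "?j > 0" using False by (cases "?j = 0") auto
        ultimately have "?j \<in> totatives n"
          using order_pos by (simp add: totatives_def less_imp_le)
        moreover have "x = g [^] ?j"
        proof -
          have "g [^] i = g [^] (n * (i div n) + ?j)" by simp
          also have "\<dots> = (g [^] n) [^] (i div n) \<otimes> g [^] ?j"
            by (simp only: nat_pow_mult nat_pow_pow gen_closed)
          also have "\<dots> = g [^] ?j" by (simp add: pow_order_eq_1)
          finally show ?thesis using i by simp
        qed
        ultimately show ?thesis by blast
      qed
    qed
  qed
  then show ?thesis by (simp add: bij_betw_same_card totient_def)
qed

section \<open>Adjacency and connectedness in terms of element orders\<close>

definition comparable_orders where
  "comparable_orders a b \<longleftrightarrow> ord a dvd ord b \<or> ord b dvd ord a"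

text \<open>Adjacency is already symmetric, so the symmetric closure adds no pairs; membership in a
  cyclic subgroup becomes divisibility of orders.\<close>

lemma symcl_arcs_ends_induced:
  assumes "V \<subseteq> nonid"
  shows "(arcs_ends (proper_power_graph G \<restriction> V))\<^sup>s =
    {(a, b). a \<in> V \<and> b \<in> V \<and> a \<noteq> b \<and> comparable_orders a b}" (is "?L = ?R")
proof -
  have *: "(a, b) \<in> arcs_ends (proper_power_graph G \<restriction> V) \<longleftrightarrow> (a, b) \<in> ?R" for a b
    using assms in_generate_iff_ord_dvd
    by (auto simp: arcs_ends_conv proper_power_graph_def power_graph_def
        pre_digraph.del_vert_def induce_subgraph_def comparable_orders_def subset_iff)
  then have "arcs_ends (proper_power_graph G \<restriction> V) = ?R"
    by (metis (no_types, lifting) subrelI subset_antisym)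
  then show ?thesis by (auto simp: symcl_def comparable_orders_def)
qed

lemma connected_induced_iff:
  assumes "V \<subseteq> nonid"
  shows "Digraph_Component.connected (proper_power_graph G \<restriction> V) \<longleftrightarrow> V \<noteq> {} \<and>
    (\<forall>u \<in> V. \<forall>v \<in> V.
       (u, v) \<in> rtrancl_on V {(a, b). a \<in> V \<and> b \<in> V \<and> a \<noteq> b \<and> comparable_orders a b})"
  by (simp add: connected_conv symcl_arcs_ends_induced[OF assms])

text \<open>\<open>comparable_orders\<close> is reflexive while adjacency is not. Allowing a = b
  here spares the path arguments below from treating coinciding vertices separately.\<close>

lemma rtrancl_on_comparable:
  assumes "a \<in> V" "b \<in> V" "comparable_orders a b"
  shows "(a, b) \<in> rtrancl_on V {(a, b). a \<in> V \<and> b \<in> V \<and> a \<noteq> b \<and> comparable_orders a b}"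
  using assms by (cases "a = b") (auto intro: rtrancl_on_into_rtrancl_on)

lemma connected_inducedI_hub:
  assumes "V \<subseteq> nonid" "c \<in> V" "\<And>v. v \<in> V \<Longrightarrow> comparable_orders c v"
  shows "Digraph_Component.connected (proper_power_graph G \<restriction> V)"
  unfolding connected_induced_iff[OF assms(1)]
proof (intro conjI ballI)
  fix u v assume uv: "u \<in> V" "v \<in> V"
  have "comparable_orders u c"
    using assms(3)[OF uv(1)] by (auto simp: comparable_orders_def)
  from rtrancl_on_trans[OF rtrancl_on_comparable[OF uv(1) assms(2) this]
      rtrancl_on_comparable[OF assms(2) uv(2) assms(3)[OF uv(2)]]]
  show "(u, v) \<in> rtrancl_on V {(a, b). a \<in> V \<and> b \<in> V \<and> a \<noteq> b \<and> comparable_orders a b}" .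
qed (use assms in blast)

lemma card_nonid: "card nonid = n - 1"
  using finite_carrier by (simp add: order_def)

lemma nonid_empty:
  assumes "n = 1"
  shows "nonid = {}"
proof -
  have "finite nonid" using finite_carrier by simp
  moreover have "card nonid = 0" using card_nonid assms by simp
  ultimately show ?thesis by (simp only: card_0_eq)
qed

text \<open>There are n - 1 vertices, so leaving exactly one means deleting n - 2. The additive form
  avoids truncated subtraction, which would go wrong for n = 1.\<close>

lemma separating_set_iff:
  "separating_set (proper_power_graph G) S \<longleftrightarrow> S \<subseteq> nonid \<and>
     (\<not> Digraph_Component.connected (proper_power_graph G \<restriction> (nonid - S)) \<or> card S + 2 = n)"
proof (cases "S \<subseteq> nonid")
  case True
  then have fin: "finite S" using finite_carrier finite_subset by blast
  then have "card (nonid - S) = n - 1 - card S"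
    using True card_nonid by (simp add: card_Diff_subset)
  moreover have "card S \<le> n - 1"
    using True card_nonid card_mono[of nonid S] finite_carrier by simp
  ultimately have "card (nonid - S) = 1 \<longleftrightarrow> card S + 2 = n" using order_pos by linarith
  with True fin show ?thesis unfolding separating_set_def verts_proper_power_graph by blast
next
  case False
  then show ?thesis unfolding separating_set_def verts_proper_power_graph by blast
qed

section \<open>Cyclic groups of prime power order\<close>

lemma vertex_connectivity_prime_power:
  assumes "prime p" "n = p ^ k"
  shows "vertex_connectivity (proper_power_graph G) = n - 2"
proof -
  have comp: "comparable_orders a b" if "a \<in> carrier G" "b \<in> carrier G" for a b
  proof -
    have "ord a dvd p ^ k" "ord b dvd p ^ k"
      using that ord_dvd_group_order[of a] ord_dvd_group_order[of b] assms(2) by simp_all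
    then obtain i j where "ord a = p ^ i" "ord b = p ^ j"
      unfolding divides_primepow_nat[OF assms(1)] by blast
    then show ?thesis by (cases "i \<le> j") (auto simp: comparable_orders_def le_imp_power_dvd)
  qed
  \<comment> \<open>All vertices but \<open>g\<close> are deleted. For n = 1 there is no vertex at
    all: \<open>S\<close> is empty, \<open>n - 2\<close> truncates to 0, and the empty graph counts
    as not connected.\<close>
  define S where "S = nonid - {g}"
  have card_S: "card S = n - 2"
  proof (cases "n = 1")
    case True
    then have "S = {}" using nonid_empty by (auto simp: S_def)
    then show ?thesis using True by simp
  next
    case False
    then have "g \<in> nonid" using ord_gen by auto
    then show ?thesis using card_nonid finite_carrier by (simp add: S_def)
  qed
  have "separating_set (proper_power_graph G) S"
  proof (cases "n = 1")
    case True
    then show ?thesis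
      using finite_verts_separating_set[of "proper_power_graph G"]
      by (simp add: S_def nonid_empty)
  next
    case False
    then show ?thesis using order_pos card_S by (auto simp: separating_set_iff S_def)
  qed
  moreover have "card S \<le> card T" if T: "separating_set (proper_power_graph G) T" for T
  proof (rule ccontr)
    assume less: "\<not> card S \<le> card T"
    have sub: "T \<subseteq> nonid" using T separating_set_iff by blast
    \<comment> \<open>A surviving \<open>c\<close> is comparable with every vertex, so what remains
      is connected. Then \<open>T\<close> can separate only by leaving a single vertex, which takes
      n - 2 deletions.\<close>
    have "T \<noteq> nonid" using less card_S card_nonid by auto
    then obtain c where c: "c \<in> nonid - T" using sub by blast
    have "Digraph_Component.connected (proper_power_graph G \<restriction> (nonid - T))"
      using c by (intro connected_inducedI_hub[OF _ c] comp) auto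
    with T have "card T + 2 = n" unfolding separating_set_iff by blast
    with less card_S show False by linarith
  qed
  ultimately show ?thesis using vertex_connectivity_eqI card_S by metis
qed

end

section \<open>Cyclic groups whose order has two distinct prime divisors\<close>

locale finite_cyclic_group_two_primes = finite_cyclic_group +
  fixes p q :: nat
  assumes primes: "prime p" "prime q" "p \<noteq> q" and dvds: "p dvd n" "q dvd n"
begin

lemma order_ne: "n \<noteq> 1" "n \<noteq> p" "n \<noteq> q"
proof -
  show "n \<noteq> 1" using primes(1) dvds(1) by (metis nat_dvd_1_iff_1 not_prime_1)
  have "\<not> q dvd p" "\<not> p dvd q" using primes primes_dvd_imp_eq by blast+
  with dvds show "n \<noteq> p" "n \<noteq> q" by blast+
qed

lemma gens_subset: "gens \<subseteq> nonid"
  using order_ne(1) by auto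

lemma finite_gens: "finite gens"
  using finite_carrier by simp

text \<open>Elements of orders \<open>p\<close> and \<open>q\<close> are two nonidentity
  nongenerators. The bound makes n - 2 strictly larger than the totient, so leaving a single vertex
  costs more than deleting all generators.\<close>

lemma totient_bound: "totient n + 3 \<le> n"
proof -
  obtain a where a: "a \<in> carrier G" "ord a = p" using obtain_element_of_order[OF dvds(1)] .
  obtain b where b: "b \<in> carrier G" "ord b = q" using obtain_element_of_order[OF dvds(2)] .
  have ab: "a \<noteq> b" "{a, b} \<subseteq> nonid - gens"
    using a b primes order_ne by auto
  have "2 \<le> card (nonid - gens)"
    using card_mono[OF _ ab(2)] ab(1) finite_carrier by simp
  also have "\<dots> = n - 1 - totient n"
    using card_Diff_subset[OF finite_gens gens_subset] card_gens card_nonid by simp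
  finally show ?thesis by simp
qed

text \<open>A surviving generator is a hub, since every element order divides n; the rest is then
  connected, and only the single-vertex alternative remains.\<close>

lemma separating_set_cases:
  assumes S: "separating_set (proper_power_graph G) S"
  shows "gens \<subseteq> S \<or> card S + 2 = n"
proof (rule ccontr)
  assume neg: "\<not> ?thesis"
  then obtain c where c: "c \<in> gens" "c \<notin> S" by blast
  have "Digraph_Component.connected (proper_power_graph G \<restriction> (nonid - S))"
  proof (rule connected_inducedI_hub)
    show "c \<in> nonid - S" using c gens_subset by blast
    show "comparable_orders c v" if "v \<in> nonid - S" for v
      using that c ord_dvd_group_order by (auto simp: comparable_orders_def)
  qed auto
  with S neg show False by (simp add: separating_set_iff)
qed

lemma totient_le_card_separating_set:
  assumes "separating_set (proper_power_graph G) S"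
  shows "totient n \<le> card S"
proof -
  have "finite S" using assms by (simp add: separating_set_def)
  then show ?thesis
    using separating_set_cases[OF assms] totient_bound card_mono[of S gens] card_gens by force
qed

lemma vertex_connectivity_prime_product:
  assumes n: "n = p * q"
  shows "vertex_connectivity (proper_power_graph G) = totient n"
proof -
  define V where "V = nonid - gens"
  have V_sub: "V \<subseteq> nonid" by (auto simp: V_def)
  have V_ord: "ord v = p \<or> ord v = q" if "v \<in> V" for v
  proof -
    have v: "v \<in> carrier G" "ord v \<noteq> 1" "ord v \<noteq> p * q"
      using that n ord_eq_1[of v] by (auto simp: V_def)
    have "ord v dvd p * q" using ord_dvd_group_order[OF v(1)] n by simp
    then obtain i j where ij: "ord v = i * j" "i dvd p" "j dvd q"
      using division_decomp by blast
    then have "i = 1 \<or> i = p" "j = 1 \<or> j = q" using primes by (auto simp: prime_nat_iff)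
    with v ij show ?thesis by auto
  qed
  obtain a where a: "a \<in> carrier G" "ord a = p" using obtain_element_of_order[OF dvds(1)] .
  obtain b where b: "b \<in> carrier G" "ord b = q" using obtain_element_of_order[OF dvds(2)] .
  have ab: "a \<in> V" "b \<in> V" using a b primes order_ne by (auto simp: V_def)
  have ndvd: "\<not> p dvd q" "\<not> q dvd p" using primes primes_dvd_imp_eq by blast+
  \<comment> \<open>Order \<open>p\<close> is preserved along each edge inside \<open>V\<close>: the
    only other order is \<open>q\<close>, and neither prime divides the other. So \<open>b\<close>
    cannot be reached from \<open>a\<close>.\<close>
  have inv: "ord v = p"
    if "(a, v) \<in> rtrancl_on V {(a, b). a \<in> V \<and> b \<in> V \<and> a \<noteq> b \<and> comparable_orders a b}" for v
    using that
  proof (induction rule: rtrancl_on_induct)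
    case (step y z)
    then show ?case using V_ord[of z] ndvd by (auto simp: comparable_orders_def)
  qed (rule a)
  have "\<not> Digraph_Component.connected (proper_power_graph G \<restriction> V)"
    using ab inv[of b] b primes unfolding connected_induced_iff[OF V_sub] by blast
  then have "separating_set (proper_power_graph G) gens"
    using gens_subset by (simp add: separating_set_iff V_def)
  from vertex_connectivity_eqI[OF this] show ?thesis
    using totient_le_card_separating_set card_gens by simp
qed

lemma connected_nongenerators:
  assumes n: "\<And>r s. prime r \<Longrightarrow> prime s \<Longrightarrow> r \<noteq> s \<Longrightarrow> n \<noteq> r * s"
  shows "Digraph_Component.connected (proper_power_graph G \<restriction> (nonid - gens))"
proof -
  define V where "V = nonid - gens"
  have V_sub: "V \<subseteq> nonid" by (auto simp: V_def)
  \<comment> \<open>As n is not prime, each prime divisor of n is a proper divisor, and elements of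
    that order are nongenerators.\<close>
  have n_not_prime: "\<not> prime n"
    using primes dvds order_ne primes_dvd_imp_eq by blast
  have ex: "\<exists>x\<in>V. ord x = d" if d: "d dvd n" "d \<noteq> 1" "d \<noteq> n" for d
  proof -
    obtain x where "x \<in> carrier G" "ord x = d" using obtain_element_of_order[OF d(1)] .
    with d show ?thesis by (auto simp: V_def)
  qed
  have ex_prime: "\<exists>r x. prime r \<and> r dvd n \<and> x \<in> V \<and> ord x = r \<and> r dvd ord u" if u: "u \<in> V" for u
  proof -
    have uc: "u \<in> carrier G" "ord u \<noteq> 1" using u ord_eq_1[of u] by (auto simp: V_def)
    then obtain r where r: "prime r" "r dvd ord u" using prime_factor_nat by blast
    have "r dvd n" using r(2) ord_dvd_group_order[OF uc(1)] by (rule dvd_trans)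
    moreover have "r \<noteq> 1" "r \<noteq> n" using r(1) n_not_prime by auto
    ultimately show ?thesis using r ex by blast
  qed
  show ?thesis
    unfolding V_def[symmetric] connected_induced_iff[OF V_sub]
  proof (intro conjI ballI)
    have "p \<noteq> 1" using primes(1) by auto
    then show "V \<noteq> {}" using ex[OF dvds(1)] order_ne by blast
    fix u v assume uv: "u \<in> V" "v \<in> V"
    let ?R = "{(a, b). a \<in> V \<and> b \<in> V \<and> a \<noteq> b \<and> comparable_orders a b}"
    obtain r a where a: "prime r" "r dvd n" "a \<in> V" "ord a = r" "r dvd ord u"
      using ex_prime[OF uv(1)] by blast
    obtain s b where b: "prime s" "s dvd n" "b \<in> V" "ord b = s" "s dvd ord v"
      using ex_prime[OF uv(2)] by blast
    \<comment> \<open>This keeps the middle vertex \<open>c\<close> of the path off the generators: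
      the lcm is a prime if r = s, and otherwise a product of two distinct primes, excluded by the
      hypothesis.\<close>
    have "lcm r s \<noteq> n"
    proof (cases "r = s")
      case True
      then show ?thesis using a n_not_prime by auto
    next
      case False
      then have "lcm r s = r * s" using a b by (simp add: lcm_coprime primes_coprime)
      then show ?thesis using n[OF a(1) b(1) False] by simp
    qed
    moreover have "lcm r s \<noteq> 1" using a(1) by auto
    ultimately obtain c where c: "c \<in> V" "ord c = lcm r s"
      using ex[of "lcm r s"] a b by auto
    have "comparable_orders u a" "comparable_orders a c" "comparable_orders c b"
      "comparable_orders b v"
      using a b c by (auto simp: comparable_orders_def)
    then have "(u, a) \<in> rtrancl_on V ?R" "(a, c) \<in> rtrancl_on V ?R"
      "(c, b) \<in> rtrancl_on V ?R" "(b, v) \<in> rtrancl_on V ?R"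
      using uv a(3) b(3) c(1) rtrancl_on_comparable by blast+
    then show "(u, v) \<in> rtrancl_on V ?R" by (blast intro: rtrancl_on_trans)
  qed
qed

text \<open>A minimum separating set of size \<open>totient n\<close> is too small to leave one
  vertex, so it contains all generators and, by cardinality, equals \<open>gens\<close>. But
  deleting \<open>gens\<close> leaves a connected graph with more than one vertex.\<close>

lemma totient_less_vertex_connectivity:
  assumes "\<And>r s. prime r \<Longrightarrow> prime s \<Longrightarrow> r \<noteq> s \<Longrightarrow> n \<noteq> r * s"
  shows "totient n < vertex_connectivity (proper_power_graph G)"
proof -
  obtain S where S: "separating_set (proper_power_graph G) S"
    "card S = vertex_connectivity (proper_power_graph G)"
    using vertex_connectivity_attained[of "proper_power_graph G"] finite_carrier by auto
  have "card S \<noteq> totient n"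
  proof
    assume card: "card S = totient n"
    have fin: "finite S" using S(1) by (simp add: separating_set_def)
    have "gens \<subseteq> S" using separating_set_cases[OF S(1)] card totient_bound by auto
    then have "S = gens" using card_subset_eq[OF fin, of gens] card card_gens by simp
    with S(1) connected_nongenerators[OF assms] card totient_bound
    show False by (simp add: separating_set_iff)
  qed
  then show ?thesis using totient_le_card_separating_set[OF S(1)] S(2) by simp
qed

end

section \<open>Generators, p-groups and prime divisors of the group order\<close>

lemma (in group) cyclic_group_imp_finite_cyclic_group:
  assumes "finite (carrier G)" "cyclic_group G"
  obtains g where "finite_cyclic_group G g"
proof -
  obtain g where g: "g \<in> carrier G" "subgroup_generated G {g} = G"
    using assms(2) unfolding cyclic_group_def by blast
  have "ord g = order G" using cyclic_order_is_ord[OF g(1)] unfolding g(2) .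
  then have "finite_cyclic_group G g" using assms(1) g(1) by unfold_locales
  then show thesis by (rule that)
qed

lemma (in group) p_group_if_order_prime_power:
  assumes "prime p" "order G = p ^ k"
  shows "p_group p G"
  unfolding p_group_def
proof (intro conjI ballI)
  fix x assume "x \<in> carrier G"
  then have "ord x dvd p ^ k" using ord_dvd_group_order[of x] assms(2) by simp
  then show "\<exists>i. ord x = p ^ i" using divides_primepow_nat[OF assms(1)] by blast
qed (use assms in simp_all)

lemma (in group) two_primes_dvd_order:
  assumes fin: "finite (carrier G)" and "\<not> (\<exists>p. p_group p G)"
  obtains p q where "prime p" "prime q" "p \<noteq> q" "p dvd order G" "q dvd order G"
proof -
  have not_pow: "order G \<noteq> p ^ k" if "prime p" for p k
    using assms(2) p_group_if_order_prime_power that by blast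
  \<comment> \<open>The trivial group has order 2^0 and so is a p-group.\<close>
  have "order G \<noteq> 1" using not_pow[OF two_is_prime_nat, of 0] by simp
  then obtain p where p: "prime p" "p dvd order G" using prime_factor_nat by blast
  have "order G \<noteq> 0" using fin order_gt_0_iff_finite by simp
  then obtain q where "q \<in> prime_factors (order G)" "q \<noteq> p"
    using Ex_other_prime_factor[of "order G" p] not_pow p(1) by auto
  then show thesis using p that by (auto simp: in_prime_factors_iff)
qed

theorem theorem3p8:
  fixes G :: "('a, 'm) monoid_scheme" and n :: nat
  assumes "group G" and "finite (carrier G)" and "cyclic_group G" and "order G = n"
  shows "((\<exists>p. p_group p G) \<longrightarrow>
            vertex_connectivity (proper_power_graph G) = n - 2) \<and>
         ((\<exists>p q :: nat. prime p \<and> prime q \<and> p \<noteq> q \<and> order G = p * q) \<longrightarrow>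
            vertex_connectivity (proper_power_graph G) = totient n) \<and>
         (\<not> (\<exists>p. p_group p G) \<and>
          \<not> (\<exists>p q :: nat. prime p \<and> prime q \<and> p \<noteq> q \<and> order G = p * q) \<longrightarrow>
            vertex_connectivity (proper_power_graph G) > totient n)"
proof -
  obtain g where g: "finite_cyclic_group G g"
    using group.cyclic_group_imp_finite_cyclic_group[OF assms(1-3)] .
  interpret finite_cyclic_group G g by (rule g)
  show ?thesis
  proof (intro conjI impI)
    assume "\<exists>p. p_group p G"
    \<comment> \<open>The p-group condition is applied to the generator \<open>g\<close>, whose
      order is that of the group.\<close>
    then obtain p k where "prime p" "order G = p ^ k"
      using ord_gen gen_closed by (metis p_group_def)
    then show "vertex_connectivity (proper_power_graph G) = n - 2"
      using vertex_connectivity_prime_power assms(4) by simp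
  next
    assume "\<exists>p q :: nat. prime p \<and> prime q \<and> p \<noteq> q \<and> order G = p * q"
    then obtain p q :: nat where pq: "prime p" "prime q" "p \<noteq> q" "order G = p * q" by blast
    interpret finite_cyclic_group_two_primes G g p q
      using pq by unfold_locales auto
    show "vertex_connectivity (proper_power_graph G) = totient n"
      using vertex_connectivity_prime_product[OF pq(4)] assms(4) by simp
  next
    assume *: "\<not> (\<exists>p. p_group p G) \<and>
      \<not> (\<exists>p q :: nat. prime p \<and> prime q \<and> p \<noteq> q \<and> order G = p * q)"
    then obtain p q where pq: "prime p" "prime q" "p \<noteq> q" "p dvd order G" "q dvd order G"
      using two_primes_dvd_order[OF finite_carrier] by blast
    interpret finite_cyclic_group_two_primes G g p q
      using pq by unfold_locales auto
    show "vertex_connectivity (proper_power_graph G) > totient n"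
      using totient_less_vertex_connectivity * assms(4) by blast
  qed
qed

end
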